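(* Let $C$ be any constant with $0<C<1/\log 4$. Then, as $N\to\infty$, uniformly over all intervals $I\subseteq\mathbb{R}$ of length $|I|>\exp\!\left(-C(\log N)^2\right)$, \[ \mathbb{P}[X_N\in I]=\int_I g(x)\,\mathrm{d}x + o(|I|), \] where \[ g(x):=2\int_0^{+\infty}\cos(2\pi u x)\prod_{n=1}^{+\infty}\cos(2\pi u/n)\,\mathrm{d}u . \]
   Context: For a positive integer $N$, $X_N:=\sum_{n=1}^N s_n/n$, where $s_1,\dots,s_N$ are independent random variables, each uniformly distributed on $\{-1,+1\}$. *)

theory Defs
  imports "HOL-Probability.Probability"
begin

definition signs :: "nat \<Rightarrow> (nat \<Rightarrow> real) set" where
  "signs N = PiE {1..N} (\<lambda>_. {-1, 1})"

definition XN :: "nat \<Rightarrow> (nat \<Rightarrow> real) \<Rightarrow> real" where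
  "XN N s = (\<Sum>n=1..N. s n / real n)"

definition probX :: "nat \<Rightarrow> real set \<Rightarrow> real" where
  "probX N I = measure_pmf.prob (pmf_of_set (signs N)) {s. XN N s \<in> I}"

definition g :: "real \<Rightarrow> real" where
  "g x = 2 * (LBINT u:{0..}. cos (2 * pi * u * x) *
              prodinf (\<lambda>n. cos (2 * pi * u / real (Suc n))))"

end

theory Submission
  imports Defs "HOL-Real_Asymp.Real_Asymp"
begin

text \<open>
  Write \<open>\<phi>\<^sub>N(u)\<close> for the product of \<open>cos (2\<pi>u/n)\<close> over \<open>n \<le> N\<close>, the characteristic function of the sum. By
  \<open>\<bar>cos t\<bar> \<le> exp (- sin\<^sup>2 t / 2)\<close> it is small as soon as \<open>2u/n\<close> is not too close to an integer
  for many \<open>n\<close>. The \<open>k\<close>-th finite difference of \<open>2u/n\<close> is \<open>2u k!/(n(n+1)\<dots>(n+k))\<close>; for \<open>n\<close> slightly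
  larger than \<open>M = (4 k! u)\<^bsup>1/(k+1)\<^esup>\<close> it lies between two positive constants and is at most
  \<open>1/2\<close>, so each block of \<open>k + 1\<close> consecutive such \<open>n\<close> contains one at which \<open>2u/n\<close> has
  distance at least of order \<open>2\<^bsup>-k\<^esup>\<close> to the integers. Up to \<open>u = exp (C (log N)\<^sup>2)\<close> one can take
  \<open>k \<le> C log N + 1\<close> approximately, and the resulting exponent \<open>M / (k\<^sup>2 4\<^sup>k)\<close> is a positive power of \<open>N\<close>
  exactly when \<open>C log 4 < 1\<close>.

  The sum is then smoothed by a Gaussian of standard deviation \<open>exp (- C' (log N)\<^sup>2)\<close> with \<open>C'\<close>
  slightly larger than \<open>C\<close>. By the decay of \<open>\<phi>\<^sub>N\<close> and dominated convergence the smoothed density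
  converges to \<open>g\<close> uniformly, and the Gaussian tail shows that smoothing changes the probability
  of an interval \<open>I\<close> by \<open>o(\<bar>I\<bar>)\<close>.
\<close>

section \<open>Decay of the characteristic function\<close>

lemma abs_sin_sum_le: "\<bar>sin (\<Sum>i\<in>A. t i)\<bar> \<le> (\<Sum>i\<in>A. \<bar>sin (t i :: real)\<bar>)"
proof (induction A rule: infinite_finite_induct)
  case (insert x F)
  have "\<bar>sin (t x + y)\<bar> \<le> \<bar>sin (t x)\<bar> + \<bar>sin y\<bar>" for y
  proof -
    have "\<bar>sin (t x + y)\<bar> \<le> \<bar>sin (t x)\<bar> * \<bar>cos y\<bar> + \<bar>cos (t x)\<bar> * \<bar>sin y\<bar>"
      unfolding sin_add by (metis abs_mult abs_triangle_ineq)
    also have "\<dots> \<le> \<bar>sin (t x)\<bar> * 1 + 1 * \<bar>sin y\<bar>"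
      by (intro add_mono mult_mono) auto
    finally show ?thesis by simp
  qed
  from this[of "\<Sum>i\<in>F. t i"] insert show ?case by simp
qed auto

lemma abs_sin_nat_mult_le: "\<bar>sin (real n * t)\<bar> \<le> real n * \<bar>sin t\<bar>"
  using abs_sin_sum_le[of "\<lambda>_. t" "{..<n}"] by simp

text \<open>Up to sign the left side is the k-th finite difference of 1/x. By Pascal's rule the
  difference of order k + 1 at x is the one of order k at x minus the one of order k at x + 1, which
  drives the induction.\<close>

lemma finite_difference_reciprocal:
  assumes "x > 0"
  shows "(\<Sum>j\<le>k. (-1) ^ j * real (k choose j) / (x + real j)) = fact k / (\<Prod>j\<le>k. x + real j)"
  using assms
proof (induction k arbitrary: x)
  case (Suc k)
  define Q where "Q = (\<Prod>j\<le>Suc k. x + real j)"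
  have Q: "Q \<noteq> 0" using Suc.prems unfolding Q_def by (subst prod_zero_iff) auto
  define f where "f j = (-1) ^ j / (x + real j)" for j :: nat
  have "(\<Sum>j\<le>Suc k. (-1) ^ j * real (Suc k choose j) / (x + real j))
      = (\<Sum>j\<le>Suc k. real (Suc k choose j) * f j)"
    by (simp add: f_def mult.commute)
  also have "\<dots> = f 0 + (\<Sum>j\<le>k. real (Suc k choose Suc j) * f (Suc j))"
    by (subst sum.atMost_Suc_shift) simp
  also have "\<dots> = (f 0 + (\<Sum>j\<le>k. real (k choose Suc j) * f (Suc j))) + (\<Sum>j\<le>k. real (k choose j) * f (Suc j))"
    by (simp add: algebra_simps sum.distrib)
  also have "f 0 + (\<Sum>j\<le>k. real (k choose Suc j) * f (Suc j)) = (\<Sum>j\<le>Suc k. real (k choose j) * f j)"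
    by (simp only: sum.atMost_Suc_shift) simp
  also have "\<dots> = (\<Sum>j\<le>k. real (k choose j) * f j)" by simp
  also have "\<dots> = fact k / (\<Prod>j\<le>k. x + real j)"
    using Suc.IH[OF Suc.prems] by (simp add: f_def mult.commute)
  also have "(\<Sum>j\<le>k. real (k choose j) * f (Suc j)) = - (fact k / (\<Prod>j\<le>k. (x + 1) + real j))"
    using Suc.IH[of "x + 1"] Suc.prems
    by (simp add: f_def mult.commute sum_negf algebra_simps)
  also have "(\<Prod>j\<le>k. (x + 1) + real j) = Q / x"
    using Suc.prems unfolding Q_def by (subst prod.atMost_Suc_shift) (simp add: add_ac)
  also have "(\<Prod>j\<le>k. x + real j) = Q / (x + real (Suc k))"
    using Suc.prems unfolding Q_def by simp
  also have "fact k / (Q / (x + real (Suc k))) + - (fact k / (Q / x)) = fact (Suc k) / Q"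
    using Suc.prems Q by (simp add: field_simps)
  finally show ?case by (simp only: Q_def)
qed auto

text \<open>The binomial combination of the angles \<open>2 * pi * u / (n + j)\<close> is a number
  in [\<alpha>, pi/2], so its sine is at least sin \<alpha>. Subadditivity of |sin| bounds that sine
  by the binomially weighted sum of the |sin| of the angles, hence by 2^k times the root of the sum
  of squares. Squaring produces the factor 4^k.\<close>

lemma sum_sin_sq_block_ge:
  fixes u :: real and n k :: nat
  assumes "n > 0" "0 \<le> \<alpha>" "\<alpha> \<le> 2 * pi * u * fact k / (\<Prod>j\<le>k. real (n + j))"
    "2 * pi * u * fact k / (\<Prod>j\<le>k. real (n + j)) \<le> pi / 2"
  shows "(sin \<alpha>)\<^sup>2 / 4 ^ k \<le> (\<Sum>j\<le>k. (sin (2 * pi * u / real (n + j)))\<^sup>2)"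
proof -
  define t where "t j = 2 * pi * u / real (n + j)" for j
  have eq: "2 * pi * u * fact k / (\<Prod>j\<le>k. real (n + j)) = (\<Sum>j\<le>k. (-1) ^ j * (real (k choose j) * t j))"
    using arg_cong[OF finite_difference_reciprocal[of "real n" k], of "\<lambda>y. 2 * pi * u * y"] assms(1)
    by (simp add: t_def sum_distrib_left mult_ac)
  have "sin \<alpha> \<le> sin (2 * pi * u * fact k / (\<Prod>j\<le>k. real (n + j)))"
    using assms(2-4) pi_gt_zero by (subst sin_mono_le_eq) linarith+
  also have "\<dots> \<le> (\<Sum>j\<le>k. \<bar>sin ((-1) ^ j * (real (k choose j) * t j))\<bar>)"
    unfolding eq using abs_sin_sum_le abs_le_D1 by blast
  also have "\<dots> \<le> (\<Sum>j\<le>k. real (k choose j) * \<bar>sin (t j)\<bar>)"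
  proof (intro sum_mono)
    fix j
    have "\<bar>sin ((-1) ^ j * (real (k choose j) * t j))\<bar> = \<bar>sin (real (k choose j) * t j)\<bar>"
      by (cases "even j") auto
    then show "\<bar>sin ((-1) ^ j * (real (k choose j) * t j))\<bar> \<le> real (k choose j) * \<bar>sin (t j)\<bar>"
      using abs_sin_nat_mult_le[of "k choose j" "t j"] by simp
  qed
  also have "\<dots> \<le> (\<Sum>j\<le>k. real (k choose j) * sqrt (\<Sum>j\<le>k. (sin (t j))\<^sup>2))"
  proof (intro sum_mono mult_left_mono)
    fix j assume "j \<in> {..k}"
    then have "(sin (t j))\<^sup>2 \<le> (\<Sum>j\<le>k. (sin (t j))\<^sup>2)"
      by (intro member_le_sum) auto
    then show "\<bar>sin (t j)\<bar> \<le> sqrt (\<Sum>j\<le>k. (sin (t j))\<^sup>2)"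
      by (metis real_sqrt_abs real_sqrt_le_iff)
  qed auto
  also have "\<dots> = 2 ^ k * sqrt (\<Sum>j\<le>k. (sin (t j))\<^sup>2)"
    by (simp add: sum_distrib_right[symmetric] of_nat_sum[symmetric] choose_row_sum del: of_nat_sum)
  finally have "sin \<alpha> / 2 ^ k \<le> sqrt (\<Sum>j\<le>k. (sin (t j))\<^sup>2)"
    by (simp add: field_simps)
  moreover have "0 \<le> sin \<alpha>" using assms by (intro sin_ge_zero) auto
  ultimately have "(sin \<alpha> / 2 ^ k)\<^sup>2 \<le> (sqrt (\<Sum>j\<le>k. (sin (t j))\<^sup>2))\<^sup>2"
    by (intro power_mono) auto
  also have "\<dots> = (\<Sum>j\<le>k. (sin (t j))\<^sup>2)" by (simp add: sum_nonneg)
  also have "(sin \<alpha> / 2 ^ k)\<^sup>2 = (sin \<alpha>)\<^sup>2 / 4 ^ k"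
    by (simp add: power_divide power2_eq_square flip: power_mult_distrib)
  finally show ?thesis by (simp add: t_def)
qed

section \<open>Exponential bounds for the finite cosine products\<close>

definition phi :: "nat \<Rightarrow> real \<Rightarrow> real" where
  "phi N u = (\<Prod>n=1..N. cos (2 * pi * u / real n))"

text \<open>The angle pi/(2 e^2) is the lower bound for the k-th difference of the angles within the
  blocks used in \<open>abs_phi_le_exp_blocks\<close>; it does not depend on k.\<close>

definition sin_gap :: real where
  "sin_gap = (sin (pi / (2 * exp 2)))\<^sup>2"

lemma sin_gap_pos: "sin_gap > 0"
proof -
  have "sin (pi / (2 * exp 2)) > 0"
    by (rule sin_gt_zero) (auto simp: field_simps intro: order.strict_trans1[OF _ mult_strict_left_mono[of 1]])
  then show ?thesis by (simp add: sin_gap_def)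
qed

lemma abs_cos_le_exp_sin_sq: "\<bar>cos x\<bar> \<le> exp (- (sin x)\<^sup>2 / 2)" for x :: real
proof -
  have "\<bar>cos x\<bar>\<^sup>2 = 1 + - (sin x)\<^sup>2" by (simp add: cos_squared_eq)
  also have "\<dots> \<le> exp (- (sin x)\<^sup>2)" by (rule exp_ge_add_one_self)
  also have "\<dots> = (exp (- (sin x)\<^sup>2 / 2))\<^sup>2" by (simp flip: exp_double)
  finally show ?thesis by (rule power2_le_imp_le) simp
qed

lemma abs_phi_le_exp_sum_sin_sq: "\<bar>phi N u\<bar> \<le> exp (- (\<Sum>n=1..N. (sin (2 * pi * u / real n))\<^sup>2) / 2)"
proof -
  have "\<bar>phi N u\<bar> \<le> (\<Prod>n=1..N. exp (- (sin (2 * pi * u / real n))\<^sup>2 / 2))"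
    unfolding phi_def abs_prod by (intro prod_mono conjI abs_cos_le_exp_sin_sq abs_ge_zero)
  also have "\<dots> = exp (- (\<Sum>n=1..N. (sin (2 * pi * u / real n))\<^sup>2) / 2)"
    by (simp add: sum_negf sum_divide_distrib flip: exp_sum)
  finally show ?thesis .
qed

lemma abs_phi_le_one: "\<bar>phi N u\<bar> \<le> 1"
  unfolding phi_def abs_prod by (intro prod_le_1) auto

text \<open>M is chosen so that the k-th difference of the angles \<open>2 * pi * u / n\<close>
  would be pi/2 if every factor of its denominator were M. With q = k + 1, the range from M to M (1
  + 2/q) contains at least M/q^2 disjoint blocks of length q, and each contributes at least
  \<open>sin_gap / 4 ^ k\<close> to the sum of squared sines. As q is at least 2, the range ends
  below 2 M and hence below N.\<close>

lemma abs_phi_le_exp_blocks: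
  fixes M u :: real and k N :: nat
  assumes k: "k \<ge> 1" and M: "M ^ (k + 1) = 4 * fact k * u" "2 * real (k + 1) ^ 2 \<le> M" and N: "2 * M \<le> real N"
  shows "\<bar>phi N u\<bar> \<le> exp (- (sin_gap / 2 * (M / (real (k + 1) ^ 2 * 4 ^ k))))"
proof -
  define q where "q = k + 1"
  define m where "m = nat \<lceil>M\<rceil>"
  \<comment> \<open>B is the number of blocks; the subtracted 1 pays for rounding M up to m.\<close>
  define B where "B = nat \<lfloor>(2 * M / real q - 1) / real q\<rfloor>"
  define f where "f n = (sin (2 * pi * u / real n))\<^sup>2" for n :: nat
  have q: "real q \<ge> 2" using k by (simp add: q_def)
  have Mq: "M / real q ^ 2 \<ge> 2" using M(2) q by (simp add: q_def field_simps)
  have M0: "M > 0" using M(2) by (smt (verit) q q_def zero_less_power)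
  have m: "M \<le> real m" "real m \<le> M + 1" unfolding m_def using M0 by linarith+
  have e: "(2 * M / real q - 1) / real q = 2 * (M / real q ^ 2) - 1 / real q"
    using q by (simp add: field_simps power2_eq_square)
  have q1: "1 / real q \<le> 1 / 2" using q by (simp add: field_simps)
  \<comment> \<open>The bound M/q^2 >= 2 lets half of 2 M/q^2 absorb both 1/q and the rounding
    down.\<close>
  have B1: "M / real q ^ 2 \<le> real B" unfolding B_def e using Mq q1 by linarith
  have "real B \<le> (2 * M / real q - 1) / real q"
    unfolding B_def using e Mq q1 by (intro of_nat_floor) linarith
  then have B2: "real B * real q \<le> 2 * M / real q - 1" using q by (simp add: field_simps)
  have top: "real m + real B * real q \<le> M * (1 + 2 / real q)"
    using m(2) B2 by (simp add: field_simps)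
  have block: "sin_gap / 4 ^ k \<le> (\<Sum>j\<le>k. f (m + i * q + j))" if "i < B" for i
    unfolding sin_gap_def f_def
  proof (rule sum_sin_sq_block_ge)
    have le: "real (m + i * q + j) \<le> M * (1 + 2 / real q)" if "j \<le> k" for j
    proof -
      have "i * q + j \<le> i * q + q" using that by (simp add: q_def)
      also have "\<dots> \<le> B * q" using \<open>i < B\<close> by (metis Suc_leI add.commute mult_Suc mult_le_mono1)
      finally have "real (m + i * q + j) \<le> real m + real B * real q"
        by (metis (mono_tags, lifting) add.assoc add_left_mono of_nat_add of_nat_le_iff of_nat_mult)
      with top show ?thesis by linarith
    qed
    have ge: "M \<le> real (m + i * q + j)" for j
      using m(1) by (rule order_trans) simp
    have "(\<Prod>j\<le>k. M) \<le> (\<Prod>j\<le>k. real (m + i * q + j))"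
      using ge M0 by (intro prod_mono) (auto intro: less_imp_le)
    then have P1: "M ^ q \<le> (\<Prod>j\<le>k. real (m + i * q + j))" by (simp add: q_def)
    have "(\<Prod>j\<le>k. real (m + i * q + j)) \<le> (\<Prod>j\<le>k. M * (1 + 2 / real q))"
      using le by (intro prod_mono) auto
    also have "\<dots> = M ^ q * (1 + 2 / real q) ^ q" by (simp add: q_def power_mult_distrib)
    \<comment> \<open>This keeps the product of the block between M^q and e^2 M^q, hence the
      difference between pi/(2 e^2) and pi/2.\<close>
    also have "(1 + 2 / real q) ^ q \<le> exp (2 / real q) ^ q"
      using q by (intro power_mono exp_ge_add_one_self) auto
    also have "exp (2 / real q) ^ q = exp 2" using q by (simp flip: exp_of_nat_mult)
    finally have P2: "(\<Prod>j\<le>k. real (m + i * q + j)) \<le> M ^ q * exp 2" using M0 by simp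
    have Mpos: "M ^ q > 0" using M0 by simp
    have eq: "2 * pi * u * fact k = pi / 2 * M ^ q" using M(1) by (simp add: q_def)
    show "pi / (2 * exp 2) \<le> 2 * pi * u * fact k / (\<Prod>j\<le>k. real (m + i * q + j))"
    proof -
      have "pi / (2 * exp 2) = pi / 2 * M ^ q / (M ^ q * exp 2)" using M0 by simp
      also have "\<dots> \<le> pi / 2 * M ^ q / (\<Prod>j\<le>k. real (m + i * q + j))"
        using P1 P2 Mpos by (intro divide_left_mono mult_pos_pos) auto
      finally show ?thesis unfolding eq .
    qed
    show "2 * pi * u * fact k / (\<Prod>j\<le>k. real (m + i * q + j)) \<le> pi / 2"
      unfolding eq using P1 Mpos by (simp add: field_simps)
    show "m + i * q > 0" using m M0 by simp
  qed auto
  have "real B * (sin_gap / 4 ^ k) = (\<Sum>i<B. sin_gap / 4 ^ k)" by simp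
  also have "\<dots> \<le> (\<Sum>i<B. \<Sum>j\<le>k. f (m + i * q + j))"
    by (intro sum_mono block) auto
  also have "\<dots> = (\<Sum>i<B. \<Sum>n=i*q..<i*q+q. f (m + n))"
  proof (rule sum.cong[OF refl])
    fix i
    show "(\<Sum>j\<le>k. f (m + i * q + j)) = (\<Sum>n=i*q..<i*q+q. f (m + n))"
      using sum.shift_bounds_nat_ivl[of "\<lambda>n. f (m + n)" 0 "i * q" q]
      by (simp add: q_def lessThan_Suc_atMost atLeast0LessThan add_ac)
  qed
  also have "\<dots> = (\<Sum>n<B * q. f (m + n))"
    by (rule sum.nat_group)
  also have "\<dots> = (\<Sum>n=m..<m + B * q. f n)"
    using sum.shift_bounds_nat_ivl[of f 0 m "B * q"] by (simp add: atLeast0LessThan add_ac)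
  also have "\<dots> \<le> (\<Sum>n=1..N. f n)"
  proof (rule sum_mono2)
    have "M * (1 + 2 / real q) \<le> M * 2" using q M0 by (intro mult_left_mono) auto
    with top N have "real (m + B * q) \<le> real N" by simp
    then have "m + B * q \<le> N" by (simp only: of_nat_le_iff)
    moreover have "m \<ge> 1" using m(1) M0 by linarith
    ultimately show "{m..<m + B * q} \<subseteq> {1..N}" by auto
  qed (auto simp: f_def)
  finally have *: "real B * (sin_gap / 4 ^ k) \<le> (\<Sum>n=1..N. f n)" .
  have "sin_gap / 2 * (M / (real (k + 1) ^ 2 * 4 ^ k)) = (M / real q ^ 2) * (sin_gap / 4 ^ k) / 2"
    by (simp add: q_def field_simps)
  also have "\<dots> \<le> real B * (sin_gap / 4 ^ k) / 2"
    using B1 sin_gap_pos by (intro divide_right_mono mult_right_mono) auto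
  also have "\<dots> \<le> (\<Sum>n=1..N. f n) / 2" using * by simp
  finally show ?thesis
    using abs_phi_le_exp_sum_sin_sq[of N u]
    unfolding f_def by (auto elim!: order_trans)
qed

text \<open>The case k = 1 of the block bound, where M = 2 sqrt u.\<close>

lemma abs_phi_le_exp_sqrt:
  assumes "16 \<le> u" "16 * u \<le> (real N)\<^sup>2"
  shows "\<bar>phi N u\<bar> \<le> exp (- (sin_gap / 16 * sqrt u))"
proof -
  have u: "4 \<le> sqrt u" using assms(1) by (simp add: real_le_rsqrt)
  have "(4 * sqrt u)\<^sup>2 \<le> (real N)\<^sup>2" using assms by (simp add: power_mult_distrib)
  then have "4 * sqrt u \<le> real N" by (rule power2_le_imp_le) simp
  then have "\<bar>phi N u\<bar> \<le> exp (- (sin_gap / 2 * (2 * sqrt u / (real (1 + 1) ^ 2 * 4 ^ 1))))"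
    using assms u by (intro abs_phi_le_exp_blocks) (auto simp: power_mult_distrib)
  then show ?thesis by simp
qed

section \<open>Decay over all frequencies, uniformly in N\<close>

text \<open>For given u the block bound is applied with the least k >= 1 for which M = (4 k!
  u)^(1/(k+1)) is at most P = N/2. Minimality forces M >= P^(k/(k+1)), while k <= C'' log N + 1
  keeps 4^k below 4 N^(1-\<kappa>). Together they give M/4^k >= N^(\<kappa>/4), which beats every
  power of u in the range.\<close>

lemma phi_decay_large:
  fixes C' :: real
  assumes C': "0 < C'" "C' < 1 / ln 4"
  shows "\<forall>\<^sub>F N in sequentially. \<forall>u. (real N)\<^sup>2 < 16 * u \<and> u \<le> exp (C' * (ln (real N))\<^sup>2) \<longrightarrow>
           \<bar>phi N u\<bar> \<le> 1 / (1 + u\<^sup>2)"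
proof -
  obtain C'' where C'': "C' < C''" "C'' < 1 / ln 4" using dense C'(2) by blast
  \<comment> \<open>With this choice 4^(C'' log N) = N^(1-\<kappa>), so \<kappa> measures the room
    left by C'' log 4 < 1.\<close>
  define \<kappa> where "\<kappa> = 1 - C'' * ln 4"
  have pos: "C'' > 0" using C' C'' by simp
  have \<kappa>: "0 < \<kappa>" "\<kappa> < 1" using C'' C' pos by (auto simp: \<kappa>_def field_simps)
  \<comment> \<open>\<open>E0\<close> and \<open>E1\<close> make the order k0, which is C'' log N
    rounded up, admissible; \<open>E2\<close> and \<open>E3\<close> serve the cases of large and of
    bounded k; \<open>E4\<close> is the size condition of the block bound; \<open>E5\<close> turns
    the resulting exponent into the stated decay.\<close>
  have E0: "\<forall>\<^sub>F N in sequentially. ln 2 + ln (C'' * ln (real N) + 1) \<le> ln (real N)"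
    using pos by real_asymp
  have E1: "\<forall>\<^sub>F N in sequentially. ln 4 + C' * ln (real N) ^ 2 \<le>
              (C'' * ln (real N)) * (ln (real N) - ln 2 - ln (C'' * ln (real N) + 1))"
    using pos C' C'' by real_asymp
  have E2: "\<forall>\<^sub>F N in sequentially. ln 2 + ln 4 \<le> \<kappa> / 4 * ln (real N)"
    using \<kappa> by real_asymp
  have E3: "\<forall>\<^sub>F N in sequentially. 1 / 4 * ln (real N) \<le> (ln (real N) - ln 2) / 2 - 2 / \<kappa> * ln 4"
    by real_asymp
  have E4: "\<forall>\<^sub>F N in sequentially. 2 * (C'' * ln (real N) + 2)\<^sup>2 \<le> real N powr (\<kappa> / 4)"
    using pos \<kappa> by real_asymp
  have E5: "\<forall>\<^sub>F N in sequentially. exp (- (sin_gap / 2 * (real N powr (\<kappa> / 4) / (C'' * ln (real N) + 2)\<^sup>2)))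
              \<le> 1 / (1 + exp (C' * (ln (real N))\<^sup>2) ^ 2)"
  proof -
    have "\<forall>\<^sub>F N in sequentially. 1 + 2 * (C' * (ln (real N))\<^sup>2) \<le>
            sin_gap / 2 * (real N powr (\<kappa> / 4) / (C'' * ln (real N) + 2)\<^sup>2)"
      using pos \<kappa> C' sin_gap_pos by real_asymp
    then show ?thesis
    proof eventually_elim
      case (elim N)
      define y where "y = C' * (ln (real N))\<^sup>2"
      have "y \<ge> 0" using C' by (simp add: y_def)
      then have "1 \<le> exp (2 * y)" by simp
      moreover have "exp (2 * y) * 2 \<le> exp (2 * y) * exp 1"
        using exp_ge_add_one_self[of 1] by (intro mult_left_mono) auto
      ultimately have "1 + exp (2 * y) \<le> exp (2 * y) * exp 1" by linarith
      then have "1 + exp (2 * y) \<le> exp (1 + 2 * y)" by (simp only: exp_add mult.commute)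
      then have "exp (- (1 + 2 * y)) \<le> 1 / (1 + exp y ^ 2)"
        by (simp only: exp_minus inverse_eq_divide exp_double)
          (intro divide_left_mono, auto simp: add_pos_pos)
      moreover have "exp (- (sin_gap / 2 * (real N powr (\<kappa> / 4) / (C'' * ln (real N) + 2)\<^sup>2))) \<le> exp (- (1 + 2 * y))"
        using elim by (simp only: y_def exp_le_cancel_iff neg_le_iff_le)
      ultimately show ?case by (simp only: y_def)
    qed
  qed
  show ?thesis
    using E0 E1 E2 E3 E4 E5 eventually_ge_at_top[of "3::nat"]
  proof eventually_elim
    case (elim N)
    define L where "L = ln (real N)"
    define P where "P = real N / 2"
    have L: "L > 0" using elim(7) by (simp add: L_def)
    have P: "P > 1" using elim(7) by (simp add: P_def)
    have lnP: "ln P = L - ln 2" using elim(7) by (simp add: P_def L_def ln_div)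
    note E = elim(1-6)[folded L_def]
    show ?case
    proof (intro allI impI)
      fix u assume u: "(real N)\<^sup>2 < 16 * u \<and> u \<le> exp (C' * (ln (real N))\<^sup>2)"
      have u0: "u > 0" using u by (smt (verit) zero_le_power2)
      define good where "good k \<longleftrightarrow> k \<ge> 1 \<and> 4 * fact k * u \<le> P ^ (k + 1)" for k :: nat
      define k0 where "k0 = nat \<lceil>C'' * L\<rceil>"
      have k0: "C'' * L \<le> real k0" "real k0 \<le> C'' * L + 1" "k0 \<ge> 1"
        using mult_pos_pos[OF pos L] unfolding k0_def by linarith+
      have "good k0"
        unfolding good_def
      proof
        have "ln (real k0) \<le> ln (C'' * L + 1)" using k0 by simp
        then have "C'' * L * (L - ln 2 - ln (C'' * L + 1)) \<le> real k0 * (L - ln 2 - ln (real k0))"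
          using k0 E(1) pos L by (intro mult_mono) auto
        with E(2) have *: "ln 4 + C' * L\<^sup>2 \<le> real k0 * (L - ln 2 - ln (real k0))" by linarith
        have "4 * fact k0 * u \<le> 4 * real k0 ^ k0 * exp (C' * L\<^sup>2)"
          using u u0 fact_le_power[of k0, where 'a=real]
          by (intro mult_mono) (auto simp: L_def)
        also have "\<dots> = exp (ln 4 + real k0 * ln (real k0) + C' * L\<^sup>2)"
          using k0 by (simp add: exp_add exp_of_nat_mult)
        also have "\<dots> \<le> exp (real (k0 + 1) * ln P)"
          using * P unfolding lnP by (simp add: algebra_simps) (smt (verit) P ln_gt_zero lnP)
        also have "\<dots> = P ^ (k0 + 1)"
          unfolding exp_of_nat_mult using P by simp
        finally show "4 * fact k0 * u \<le> P ^ (k0 + 1)" .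
      qed (use k0 in auto)
      define k where "k = (LEAST k. good k)"
      have k: "good k" unfolding k_def using \<open>good k0\<close> by (rule LeastI)
      have "k \<le> k0" unfolding k_def using \<open>good k0\<close> by (rule Least_le)
      then have k_le: "real k \<le> C'' * L + 1" using k0 by linarith
      \<comment> \<open>The assumption 16 u > N^2 says exactly that k = 1 fails. Hence k - 1 is
        still at least 1, and its failure must come from the inequality, which yields
        \<open>lower\<close>.\<close>
      have "\<not> good 1" using u by (simp add: good_def P_def power2_eq_square)
      then have "k \<noteq> 1" using k by metis
      then have k2: "k \<ge> 2" using k by (simp add: good_def)
      have "\<not> good (k - 1)" unfolding k_def by (rule not_less_Least) (use k2 in \<open>simp flip: k_def\<close>)
      then have lower: "P ^ k < 4 * fact (k - 1) * u" using k2 by (auto simp: good_def not_le)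
      define M where "M = root (k + 1) (4 * fact k * u)"
      have M: "M ^ (k + 1) = 4 * fact k * u" "M > 0"
        using u0 by (auto simp: M_def simp del: power_Suc)
      have "M ^ (k + 1) \<le> P ^ (k + 1)" unfolding M using k by (simp add: good_def)
      then have MP: "M \<le> P" using P power_le_imp_le_base[of M k P] by simp
      have "P ^ k \<le> M ^ (k + 1)"
      proof -
        have "P ^ k \<le> 1 * (4 * fact (k - 1) * u)" using lower by simp
        also have "\<dots> \<le> real k * (4 * fact (k - 1) * u)" using k2 u0 by (intro mult_right_mono) auto
        also have "\<dots> = M ^ (k + 1)" unfolding M(1) using k2 by (simp add: fact_reduce[of k])
        finally show ?thesis .
      qed
      then have "ln (P ^ k) \<le> ln (M ^ (k + 1))" using P M(2) by (subst ln_le_cancel_iff) auto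
      then have "real k * ln P \<le> real (k + 1) * ln M" using P M(2) by (simp only: ln_realpow)
      then have "real k / real (k + 1) * ln P \<le> ln M" by (simp add: field_simps)
      \<comment> \<open>The exponent k/(k+1) costs a fraction 1/(k+1) of log P. For k + 1 >=
        2/\<kappa> this is at most \<kappa>/2, less than the room \<kappa> left by 4^k. For smaller
        k the factor 4^k is bounded and k/(k+1) >= 1/2 suffices.\<close>
      moreover have "\<kappa> / 4 * L \<le> real k / real (k + 1) * ln P - real k * ln 4"
      proof (cases "real (k + 1) \<ge> 2 / \<kappa>")
        case True
        have "1 - \<kappa> / 2 \<le> real k / real (k + 1)" using True \<kappa> by (simp add: field_simps)
        then have "(1 - \<kappa> / 2) * ln P \<le> real k / real (k + 1) * ln P"
          using P by (intro mult_right_mono) auto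
        moreover have "(1 - \<kappa> / 2) * ln P \<ge> (1 - \<kappa> / 2) * L - ln 2"
          unfolding lnP using \<kappa> by (simp add: algebra_simps)
        moreover have "real k * ln 4 \<le> (C'' * L + 1) * ln 4" using k_le by (intro mult_right_mono) auto
        moreover have "(C'' * L + 1) * ln 4 = (1 - \<kappa>) * L + ln 4" by (simp add: \<kappa>_def algebra_simps)
        moreover have "(1 - \<kappa> / 2) * L - (1 - \<kappa>) * L = \<kappa> / 4 * L + \<kappa> / 4 * L" by (simp add: algebra_simps)
        ultimately show ?thesis using E(3) by linarith
      next
        case False
        have "1 / 2 \<le> real k / real (k + 1)" using k2 by (simp add: field_simps)
        then have "1 / 2 * ln P \<le> real k / real (k + 1) * ln P"
          using P by (intro mult_right_mono) auto
        then have a: "(L - ln 2) / 2 \<le> real k / real (k + 1) * ln P" by (simp add: lnP)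
        have b: "real k * ln 4 \<le> 2 / \<kappa> * ln 4" using False by (intro mult_right_mono) auto
        have "\<kappa> / 4 * L \<le> 1 / 4 * L" using \<kappa> L by (intro mult_right_mono) auto
        also note E(4)
        also note diff_mono[OF a b]
        finally show ?thesis .
      qed
      ultimately have "\<kappa> / 4 * L \<le> ln M - real k * ln 4" by linarith
      then have "exp (\<kappa> / 4 * L) \<le> exp (ln M - real k * ln 4)" by simp
      also have "\<dots> = M / 4 ^ k" using M by (simp add: exp_diff exp_of_nat_mult)
      finally have M4: "real N powr (\<kappa> / 4) \<le> M / 4 ^ k"
        using elim(7) by (simp add: powr_def L_def)
      have "M / 4 ^ k \<le> M / 1" using M by (intro divide_left_mono) auto
      then have "real N powr (\<kappa> / 4) \<le> M" using M4 by simp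
      moreover have kL: "(real (k + 1))\<^sup>2 \<le> (C'' * L + 2)\<^sup>2" using k_le by (intro power_mono) auto
      ultimately have M2: "2 * real (k + 1) ^ 2 \<le> M" using E(5) by linarith
      have "\<bar>phi N u\<bar> \<le> exp (- (sin_gap / 2 * (M / (real (k + 1) ^ 2 * 4 ^ k))))"
        using k2 M M2 MP by (intro abs_phi_le_exp_blocks) (auto simp: P_def)
      also have "M / (real (k + 1) ^ 2 * 4 ^ k) = (M / 4 ^ k) / real (k + 1) ^ 2" by simp
      also have "exp (- (sin_gap / 2 * ((M / 4 ^ k) / real (k + 1) ^ 2)))
          \<le> exp (- (sin_gap / 2 * (real N powr (\<kappa> / 4) / (C'' * L + 2)\<^sup>2)))"
      proof -
        have "real N powr (\<kappa> / 4) / (C'' * L + 2)\<^sup>2 \<le> (M / 4 ^ k) / real (k + 1) ^ 2"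
          using kL M4 M by (intro frac_le) auto
        then have "sin_gap / 2 * (real N powr (\<kappa> / 4) / (C'' * L + 2)\<^sup>2) \<le> sin_gap / 2 * ((M / 4 ^ k) / real (k + 1) ^ 2)"
          using sin_gap_pos by (intro mult_left_mono) auto
        then show ?thesis by simp
      qed
      also have "\<dots> \<le> 1 / (1 + exp (C' * L\<^sup>2) ^ 2)" by (rule E(6))
      also have "\<dots> \<le> 1 / (1 + u\<^sup>2)"
        using u u0 by (intro divide_left_mono add_left_mono power_mono) (auto simp: L_def add_pos_nonneg)
      finally show "\<bar>phi N u\<bar> \<le> 1 / (1 + u\<^sup>2)" .
    qed
  qed
qed

text \<open>Below the threshold u0 of the eventual bound only v <= 1 is used, so 1 + u0^2 serves as
  A.\<close>

lemma eventually_dominated_imp_dominated: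
  fixes f :: "real \<Rightarrow> real"
  assumes "\<forall>\<^sub>F u in at_top. f u \<le> 1 / (1 + u\<^sup>2)"
  obtains A where "A \<ge> 1" "\<And>u v. 0 \<le> u \<Longrightarrow> v \<le> f u \<Longrightarrow> v \<le> 1 \<Longrightarrow> v \<le> A / (1 + u\<^sup>2)"
proof -
  obtain u0 where u0: "\<And>u. u \<ge> u0 \<Longrightarrow> f u \<le> 1 / (1 + u\<^sup>2)"
    using assms by (auto simp: eventually_at_top_linorder)
  show ?thesis
  proof (rule that[of "1 + u0\<^sup>2"])
    fix u v :: real assume uv: "0 \<le> u" "v \<le> f u" "v \<le> 1"
    show "v \<le> (1 + u0\<^sup>2) / (1 + u\<^sup>2)"
    proof (cases "u \<ge> u0")
      case True
      have "v \<le> 1 / (1 + u\<^sup>2)" using u0[OF True] uv by linarith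
      also have "\<dots> \<le> (1 + u0\<^sup>2) / (1 + u\<^sup>2)" by (intro divide_right_mono) auto
      finally show ?thesis .
    next
      case False
      then have "u\<^sup>2 \<le> u0\<^sup>2" using uv by (intro power_mono) auto
      then have "1 \<le> (1 + u0\<^sup>2) / (1 + u\<^sup>2)" by (simp add: add_pos_nonneg)
      with uv show ?thesis by linarith
    qed
  qed simp
qed

text \<open>The bound exp(-c sqrt u) depends on u alone, so one constant A works for all N; the
  trivial bound 1 covers u < 16.\<close>

lemma phi_decay_small:
  obtains A where "A \<ge> 1"
    "\<And>N u. 0 \<le> u \<Longrightarrow> 16 * u \<le> (real N)\<^sup>2 \<Longrightarrow> \<bar>phi N u\<bar> \<le> A / (1 + u\<^sup>2)"
proof -
  define f where "f u = (if u < 16 then 1 else exp (- (sin_gap / 16 * sqrt u)))" for u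
  have "\<forall>\<^sub>F u in at_top. exp (- (sin_gap / 16 * sqrt u)) \<le> 1 / (1 + u\<^sup>2)"
    using sin_gap_pos by real_asymp
  then have "\<forall>\<^sub>F u in at_top. f u \<le> 1 / (1 + u\<^sup>2)"
    using eventually_ge_at_top[of 16] by eventually_elim (simp add: f_def)
  then obtain A where A: "A \<ge> 1" "\<And>u v. 0 \<le> u \<Longrightarrow> v \<le> f u \<Longrightarrow> v \<le> 1 \<Longrightarrow> v \<le> A / (1 + u\<^sup>2)"
    using eventually_dominated_imp_dominated by blast
  show ?thesis
  proof (rule that[OF A(1)], rule A(2))
    fix N u assume "0 \<le> u" "16 * u \<le> (real N)\<^sup>2"
    then show "\<bar>phi N u\<bar> \<le> f u"
      using abs_phi_le_exp_sqrt[of u N] abs_phi_le_one[of N u] by (simp add: f_def)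
  qed (auto simp: abs_phi_le_one)
qed

text \<open>This supplies a majorant independent of N for dominated convergence. Up to u = exp(C'
  (log N)^2) the decay comes from \<open>phi\<close>; beyond that the Gaussian factor takes over,
  because the smoothing scale exp(-C2 (log N)^2) is much larger than 1/u there.\<close>

lemma smoothed_phi_decay:
  fixes C2 C' :: real
  assumes "0 < C2" "C2 < C'" "C' < 1 / ln 4"
  obtains A where "A \<ge> 1"
    "\<forall>\<^sub>F N in sequentially. \<forall>u\<ge>0. \<bar>phi N u * exp (- 2 * pi\<^sup>2 * (exp (- C2 * (ln (real N))\<^sup>2))\<^sup>2 * u\<^sup>2)\<bar> \<le> A / (1 + u\<^sup>2)"
proof -
  obtain A1 where A1: "A1 \<ge> 1"
    "\<And>N u. 0 \<le> u \<Longrightarrow> 16 * u \<le> (real N)\<^sup>2 \<Longrightarrow> \<bar>phi N u\<bar> \<le> A1 / (1 + u\<^sup>2)"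
    using phi_decay_small by blast
  \<comment> \<open>Let \<delta> be the smoothing scale. If u > exp(C' (log N)^2), then \<delta> >=
    u^(-\<theta>), so \<delta> u >= u^(1-\<theta>). The Gaussian is then bounded by a function of u
    alone, and \<theta> < 1 makes that function decay.\<close>
  define \<theta> where "\<theta> = C2 / C'"
  have \<theta>: "0 < \<theta>" "\<theta> < 1" using assms by (auto simp: \<theta>_def)
  have "\<forall>\<^sub>F u in at_top. exp (- (u powr (2 - 2 * \<theta>))) \<le> 1 / (1 + u\<^sup>2)"
    using \<theta> by real_asymp
  then obtain A2 where A2: "A2 \<ge> 1"
    "\<And>u v. 0 \<le> u \<Longrightarrow> v \<le> exp (- (u powr (2 - 2 * \<theta>))) \<Longrightarrow> v \<le> 1 \<Longrightarrow> v \<le> A2 / (1 + u\<^sup>2)"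
    using eventually_dominated_imp_dominated[of "\<lambda>u. exp (- (u powr (2 - 2 * \<theta>)))"] by blast
  define A where "A = max A1 A2"
  show ?thesis
  proof (rule that[of A])
    show "A \<ge> 1" using A1 by (simp add: A_def)
    have "0 < C'" using assms by simp
    from phi_decay_large[OF this assms(3)]
    show "\<forall>\<^sub>F N in sequentially. \<forall>u\<ge>0. \<bar>phi N u * exp (- 2 * pi\<^sup>2 * (exp (- C2 * (ln (real N))\<^sup>2))\<^sup>2 * u\<^sup>2)\<bar> \<le> A / (1 + u\<^sup>2)"
    proof eventually_elim
      case (elim N)
      show ?case
      proof (intro allI impI)
        fix u :: real assume u: "u \<ge> 0"
        define \<delta> where "\<delta> = exp (- C2 * (ln (real N))\<^sup>2)"
        define e where "e = exp (- 2 * pi\<^sup>2 * \<delta>\<^sup>2 * u\<^sup>2)"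
        have e: "0 \<le> e" "e \<le> 1" by (auto simp: e_def)
        have le: "\<bar>phi N u * e\<bar> \<le> \<bar>phi N u\<bar>" "\<bar>phi N u * e\<bar> \<le> e"
          using e abs_phi_le_one[of N u] by (auto simp: abs_mult mult_left_le mult_left_le_one_le)
        have up: "v \<le> A / (1 + u\<^sup>2)" if "v \<le> a / (1 + u\<^sup>2)" "a \<le> A" for a v
          using that by (meson add_nonneg_nonneg divide_right_mono order_trans zero_le_one zero_le_power2)
        consider "16 * u \<le> (real N)\<^sup>2" | "16 * u > (real N)\<^sup>2" "u \<le> exp (C' * (ln (real N))\<^sup>2)"
          | "u > exp (C' * (ln (real N))\<^sup>2)" by linarith
        then have "\<bar>phi N u * e\<bar> \<le> A / (1 + u\<^sup>2)"
        proof cases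
          case 1
          show ?thesis using A1(2)[OF u 1] le by (intro up[of _ A1]) (auto simp: A_def)
        next
          case 2
          then have "\<bar>phi N u\<bar> \<le> 1 / (1 + u\<^sup>2)" using elim by blast
          then show ?thesis using A1 le by (intro up[of _ 1]) (auto simp: A_def)
        next
          case 3
          then have u0: "u > 0" using exp_gt_zero less_trans by blast
          have "C' * (ln (real N))\<^sup>2 \<le> ln u" using 3 u0 by (metis less_imp_le ln_exp ln_le_cancel_iff exp_gt_zero)
          then have "\<theta> * (C' * (ln (real N))\<^sup>2) \<le> \<theta> * ln u" using \<theta> by (intro mult_left_mono) auto
          then have "C2 * (ln (real N))\<^sup>2 \<le> \<theta> * ln u" using assms by (simp add: \<theta>_def)
          then have "u powr (- \<theta>) \<le> \<delta>" using u0 by (simp add: powr_def \<delta>_def)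
          then have "(u powr (- \<theta>) * u)\<^sup>2 \<le> (\<delta> * u)\<^sup>2" using u0 by (intro power_mono mult_right_mono) auto
          also have "(u powr (- \<theta>) * u)\<^sup>2 = u powr (2 - 2 * \<theta>)"
          proof -
            have "u powr (2 - 2 * \<theta>) = u powr (- \<theta> + 1) * u powr (- \<theta> + 1)"
              by (simp flip: powr_add)
            also have "u powr (- \<theta> + 1) = u powr (- \<theta>) * u" using u0 by (subst powr_add) simp
            finally show ?thesis by (simp add: power2_eq_square)
          qed
          also have "(\<delta> * u)\<^sup>2 \<le> 2 * pi\<^sup>2 * (\<delta> * u)\<^sup>2"
          proof -
            have "1 * 1 \<le> pi * pi" using pi_gt3 by (intro mult_mono) auto
            then have "1 \<le> 2 * pi\<^sup>2" by (simp add: power2_eq_square)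
            then show ?thesis using mult_right_mono[of 1 "2 * pi\<^sup>2" "(\<delta> * u)\<^sup>2"] by simp
          qed
          finally have "e \<le> exp (- (u powr (2 - 2 * \<theta>)))" by (simp add: e_def power_mult_distrib)
          then show ?thesis using A2(2)[OF u _ e(2)] le by (intro up[of _ A2]) (auto simp: A_def)
        qed
        then show "\<bar>phi N u * exp (- 2 * pi\<^sup>2 * (exp (- C2 * (ln (real N))\<^sup>2))\<^sup>2 * u\<^sup>2)\<bar> \<le> A / (1 + u\<^sup>2)"
          by (simp only: e_def \<delta>_def)
      qed
    qed
  qed
qed

section \<open>Convergence of the smoothed density\<close>

definition phi_lim :: "real \<Rightarrow> real" where
  "phi_lim u = prodinf (\<lambda>n. cos (2 * pi * u / real (Suc n)))"

text \<open>From |cos x - 1| <= x^2/2 and the convergence of the sum of 1/n^2 the product converges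
  absolutely. Its value is the limit of the partial products also at those u where some factor
  vanishes.\<close>

lemma phi_tendsto_phi_lim: "(\<lambda>N. phi N u) \<longlonglongrightarrow> phi_lim u"
proof -
  have "summable (\<lambda>n. norm (cos (2 * pi * u / real (Suc n)) - 1))"
  proof (rule summable_comparison_test)
    show "summable (\<lambda>n. (2 * pi * u)\<^sup>2 / 2 * (1 / real (Suc n) ^ 2))"
      using inverse_squares_sums by (intro summable_mult) (auto simp: sums_iff)
    have cos_diff: "\<bar>cos x - 1\<bar> \<le> x\<^sup>2 / 2" for x :: real
    proof -
      have "cos x = 1 - 2 * (sin (x / 2))\<^sup>2" using cos_double_sin[of "x / 2"] by simp
      moreover have "(sin (x / 2))\<^sup>2 \<le> (x / 2)\<^sup>2"
        using abs_sin_x_le_abs_x[of "x / 2"] by (simp only: abs_le_square_iff)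
      ultimately show ?thesis by (simp add: power_divide)
    qed
    have "\<bar>cos (2 * pi * u / real (Suc n)) - 1\<bar> \<le> (2 * pi * u)\<^sup>2 / 2 * (1 / real (Suc n) ^ 2)" for n
      using cos_diff[of "2 * pi * u / real (Suc n)"] by (simp add: power_divide)
    then show "\<exists>N. \<forall>n\<ge>N. norm (norm (cos (2 * pi * u / real (Suc n)) - 1)) \<le> (2 * pi * u)\<^sup>2 / 2 * (1 / real (Suc n) ^ 2)"
      by simp
  qed
  then have "convergent_prod (\<lambda>n. cos (2 * pi * u / real (Suc n)))"
    by (intro abs_convergent_prod_imp_convergent_prod summable_imp_abs_convergent_prod)
  then have "(\<lambda>n. \<Prod>i\<le>n. cos (2 * pi * u / real (Suc i))) \<longlonglongrightarrow> phi_lim u"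
    unfolding phi_lim_def by (rule convergent_prod_LIMSEQ)
  moreover have "(\<Prod>i\<le>n. cos (2 * pi * u / real (Suc i))) = phi (Suc n) u" for n
    by (induction n) (simp_all add: phi_def)
  ultimately show ?thesis by (subst filterlim_sequentially_Suc[symmetric]) simp
qed

lemma measurable_phi [measurable]: "phi N \<in> borel_measurable borel"
  unfolding phi_def[abs_def] by measurable

lemma measurable_phi_lim [measurable]: "phi_lim \<in> borel_measurable borel"
  by (rule borel_measurable_LIMSEQ_real[OF phi_tendsto_phi_lim]) measurable

section \<open>Fourier representation of the smoothed density\<close>

lemma integral_even_eq_half_line:
  fixes f :: "real \<Rightarrow> real"
  assumes "integrable lborel f" "\<And>x. f (- x) = f x"
  shows "integral\<^sup>L lborel f = 2 * (LBINT x:{0..}. f x)"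
proof -
  have "integrable lborel (\<lambda>x. indicator {0..} x *\<^sub>R f x)"
    using assms(1) by (intro integrable_mult_indicator) auto
  then have "has_bochner_integral lborel (\<lambda>x. indicator {0..} x *\<^sub>R f x) (LBINT x:{0..}. f x)"
    unfolding set_lebesgue_integral_def by (rule has_bochner_integral_integrable)
  from has_bochner_integral_even_function[OF this assms(2)] show ?thesis
    by (simp add: has_bochner_integral_iff)
qed

lemma integral_std_normal_cos:
  "integrable lborel (\<lambda>x. std_normal_density x * cos (T * x))"
  "(\<integral>x. std_normal_density x * cos (T * x) \<partial>lborel) = exp (- T\<^sup>2 / 2)"
proof -
  interpret real_distribution std_normal_distribution by (rule real_dist_normal_dist)
  show "integrable lborel (\<lambda>x. std_normal_density x * cos (T * x))"
    by (rule Bochner_Integration.integrable_bound[OF integrable_normal_density[of 1 0]])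
       (auto simp: abs_mult mult_left_le)
  have "(\<integral>x. std_normal_density x * cos (T * x) \<partial>lborel) = (\<integral>x. Re (iexp (T * x)) \<partial>std_normal_distribution)"
    by (subst integral_density) (auto simp: Re_exp)
  also have "\<dots> = Re (char std_normal_distribution T)"
    unfolding char_def by (intro integral_Re integrable_iexp) auto
  also have "\<dots> = exp (- T\<^sup>2 / 2)" by (simp add: char_std_normal_distribution)
  finally show "(\<integral>x. std_normal_density x * cos (T * x) \<partial>lborel) = exp (- T\<^sup>2 / 2)" .
qed

text \<open>Fourier inversion for a Gaussian, made explicit: the known characteristic function of
  the standard normal law is evaluated at T = (y - t)/\<delta> and the variable is rescaled by c = 2
  pi \<delta>. Evenness of the integrand reduces the integral to the half line.\<close>

lemma normal_density_fourier:
  assumes "\<delta> > 0"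
  shows "integrable lborel (\<lambda>u. exp (- 2 * pi\<^sup>2 * \<delta>\<^sup>2 * u\<^sup>2) * cos (2 * pi * u * (y - t)))"
    and "normal_density t \<delta> y = 2 * (LBINT u:{0..}. exp (- 2 * pi\<^sup>2 * \<delta>\<^sup>2 * u\<^sup>2) * cos (2 * pi * u * (y - t)))"
proof -
  define T where "T = (y - t) / \<delta>"
  define c where "c = 2 * pi * \<delta>"
  define f where "f u = exp (- 2 * pi\<^sup>2 * \<delta>\<^sup>2 * u\<^sup>2) * cos (2 * pi * u * (y - t))" for u
  have c: "c > 0" using assms by (simp add: c_def)
  have eq: "std_normal_density (0 + c * u) * cos (T * (0 + c * u)) = 1 / sqrt (2 * pi) * f u" for u
  proof -
    have "T * (c * u) = 2 * pi * u * (y - t)" using assms by (simp add: T_def c_def)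
    moreover have "- (c * u)\<^sup>2 / 2 = - 2 * pi\<^sup>2 * \<delta>\<^sup>2 * u\<^sup>2" by (simp add: c_def power_mult_distrib)
    ultimately show ?thesis by (simp only: std_normal_density_def f_def add_0 mult.assoc)
  qed
  have "integrable lborel (\<lambda>u. std_normal_density (0 + c * u) * cos (T * (0 + c * u)))"
    using c by (intro lborel_integrable_real_affine integral_std_normal_cos) auto
  then have "integrable lborel (\<lambda>u. sqrt (2 * pi) * (1 / sqrt (2 * pi) * f u))"
    unfolding eq by (rule integrable_mult_right)
  then have int: "integrable lborel f" by simp
  then show "integrable lborel (\<lambda>u. exp (- 2 * pi\<^sup>2 * \<delta>\<^sup>2 * u\<^sup>2) * cos (2 * pi * u * (y - t)))"
    by (simp only: f_def[abs_def])
  have "exp (- T\<^sup>2 / 2) = \<bar>c\<bar> *\<^sub>R (\<integral>u. std_normal_density (0 + c * u) * cos (T * (0 + c * u)) \<partial>lborel)"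
    unfolding integral_std_normal_cos(2)[symmetric] using c by (intro lborel_integral_real_affine) auto
  also have "\<dots> = c / sqrt (2 * pi) * integral\<^sup>L lborel f"
    unfolding eq using c by simp
  finally have "integral\<^sup>L lborel f = sqrt (2 * pi) / c * exp (- T\<^sup>2 / 2)"
    using c by (simp add: field_simps)
  also have "sqrt (2 * pi) / c = 1 / sqrt (2 * pi * \<delta>\<^sup>2)"
  proof -
    have "sqrt (2 * pi) * sqrt (2 * pi) = 2 * pi" by simp
    then show ?thesis using assms by (simp add: c_def real_sqrt_mult divide_simps)
  qed
  also have "- T\<^sup>2 / 2 = - (y - t)\<^sup>2 / (2 * \<delta>\<^sup>2)" by (simp add: T_def power_divide)
  finally have "normal_density t \<delta> y = integral\<^sup>L lborel f" by (simp add: normal_density_def)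
  also have "\<dots> = 2 * (LBINT u:{0..}. f u)"
    using int by (rule integral_even_eq_half_line) (simp add: f_def)
  finally show "normal_density t \<delta> y = 2 * (LBINT u:{0..}. exp (- 2 * pi\<^sup>2 * \<delta>\<^sup>2 * u\<^sup>2) * cos (2 * pi * u * (y - t)))"
    by (simp only: f_def)
qed

lemma finite_signs: "finite (signs N)"
  unfolding signs_def by (intro finite_PiE) auto

lemma card_signs: "card (signs N) = 2 ^ N"
  unfolding signs_def by (subst card_PiE) (auto simp: numeral_2_eq_2)

text \<open>In exponential form the sum over all sign choices factors into a product over n with
  factors exp(i x) + exp(-i x) = 2 cos x. That product is real, so taking real parts after
  multiplying by \<open>cis (2 * pi * u * y)\<close> leaves just the cosine in y.\<close>

lemma sum_cos_signs:
  "(\<Sum>s\<in>signs N. cos (2 * pi * u * (y - XN N s))) = 2 ^ N * (cos (2 * pi * u * y) * phi N u)"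
proof -
  have "(\<Sum>s\<in>signs N. cis (- (2 * pi * u * XN N s)))
      = (\<Sum>s\<in>signs N. \<Prod>n=1..N. cis (- (2 * pi * u / real n) * s n))"
  proof (rule sum.cong[OF refl])
    fix s
    have "- (2 * pi * u * XN N s) = (\<Sum>n=1..N. - (2 * pi * u / real n) * s n)"
      by (simp add: XN_def sum_distrib_left sum_negf)
    moreover have "cis (\<Sum>n=1..N. f n) = (\<Prod>n=1..N. cis (f n))" for f :: "nat \<Rightarrow> real"
      by (simp add: cis_conv_exp sum_distrib_left exp_sum)
    ultimately show "cis (- (2 * pi * u * XN N s)) = (\<Prod>n=1..N. cis (- (2 * pi * u / real n) * s n))"
      by simp
  qed
  also have "\<dots> = (\<Prod>n=1..N. \<Sum>e\<in>{-1, 1}. cis (- (2 * pi * u / real n) * e))"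
    unfolding signs_def by (rule prod_sum_PiE[symmetric]) auto
  also have "\<dots> = (\<Prod>n=1..N. complex_of_real (2 * cos (2 * pi * u / real n)))"
    by (intro prod.cong refl) (auto simp: complex_eq_iff)
  also have "\<dots> = complex_of_real (2 ^ N * phi N u)"
    by (simp add: phi_def prod.distrib)
  finally have *: "(\<Sum>s\<in>signs N. cis (- (2 * pi * u * XN N s))) = complex_of_real (2 ^ N * phi N u)" .
  have "(\<Sum>s\<in>signs N. cos (2 * pi * u * (y - XN N s)))
      = Re (\<Sum>s\<in>signs N. cis (2 * pi * u * y) * cis (- (2 * pi * u * XN N s)))"
    by (simp add: cis_mult algebra_simps)
  also have "\<dots> = Re (cis (2 * pi * u * y) * complex_of_real (2 ^ N * phi N u))"
    unfolding sum_distrib_left[symmetric] * ..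
  finally show ?thesis by simp
qed

text \<open>For \<delta> > 0 this is the density of X_N plus an independent centred Gaussian of
  standard deviation \<delta>.\<close>

definition smoothed_density :: "nat \<Rightarrow> real \<Rightarrow> real \<Rightarrow> real" where
  "smoothed_density N \<delta> y = (\<Sum>s\<in>signs N. normal_density (XN N s) \<delta> y) / 2 ^ N"

lemma measurable_smoothed_density [measurable]: "smoothed_density N \<delta> \<in> borel_measurable borel"
  unfolding smoothed_density_def[abs_def] by measurable

lemma integrable_smoothed_density: "\<delta> > 0 \<Longrightarrow> integrable lborel (smoothed_density N \<delta>)"
  unfolding smoothed_density_def[abs_def]
  by (intro integrable_divide Bochner_Integration.integrable_sum) auto

lemma smoothed_density_fourier:
  assumes "\<delta> > 0"
  shows "smoothed_density N \<delta> y =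
    2 * (LBINT u:{0..}. cos (2 * pi * u * y) * (phi N u * exp (- 2 * pi\<^sup>2 * \<delta>\<^sup>2 * u\<^sup>2)))"
proof -
  have int: "set_integrable lborel {0..} (\<lambda>u. exp (- 2 * pi\<^sup>2 * \<delta>\<^sup>2 * u\<^sup>2) * cos (2 * pi * u * (y - t)))" for t
    unfolding set_integrable_def using normal_density_fourier(1)[OF assms]
    by (intro integrable_mult_indicator) auto
  have "smoothed_density N \<delta> y =
      (\<Sum>s\<in>signs N. 2 * (LBINT u:{0..}. exp (- 2 * pi\<^sup>2 * \<delta>\<^sup>2 * u\<^sup>2) * cos (2 * pi * u * (y - XN N s)))) / 2 ^ N"
    unfolding smoothed_density_def by (simp only: normal_density_fourier(2)[OF assms])
  also have "\<dots> = 2 * (\<Sum>s\<in>signs N. LBINT u:{0..}. exp (- 2 * pi\<^sup>2 * \<delta>\<^sup>2 * u\<^sup>2) * cos (2 * pi * u * (y - XN N s))) / 2 ^ N"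
    by (simp only: sum_distrib_left)
  also have "(\<Sum>s\<in>signs N. LBINT u:{0..}. exp (- 2 * pi\<^sup>2 * \<delta>\<^sup>2 * u\<^sup>2) * cos (2 * pi * u * (y - XN N s)))
      = (LBINT u:{0..}. \<Sum>s\<in>signs N. exp (- 2 * pi\<^sup>2 * \<delta>\<^sup>2 * u\<^sup>2) * cos (2 * pi * u * (y - XN N s)))"
    unfolding set_lebesgue_integral_def scaleR_sum_right
    by (rule Bochner_Integration.integral_sum[symmetric]) (use int in \<open>simp add: set_integrable_def\<close>)
  also have "\<dots> = (LBINT u:{0..}. 2 ^ N * (cos (2 * pi * u * y) * (phi N u * exp (- 2 * pi\<^sup>2 * \<delta>\<^sup>2 * u\<^sup>2))))"
    unfolding sum_distrib_left[symmetric] sum_cos_signs by (simp only: mult_ac)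
  also have "\<dots> = 2 ^ N * (LBINT u:{0..}. cos (2 * pi * u * y) * (phi N u * exp (- 2 * pi\<^sup>2 * \<delta>\<^sup>2 * u\<^sup>2)))"
    by (rule set_integral_mult_right)
  finally show ?thesis by simp
qed

section \<open>Uniform convergence to the limiting density\<close>

lemma set_integrable_inverse_one_plus_square:
  "set_integrable lborel {0..} (\<lambda>u::real. A / (1 + u\<^sup>2))"
proof -
  have "set_integrable lborel {0..} (\<lambda>x::real. inverse (1 + x^2))"
    by (rule set_integrable_subset[OF integrable_inverse_1_plus_square]) auto
  then have "set_integrable lborel {0..} (\<lambda>x::real. A * inverse (1 + x^2))"
    by (rule set_integrable_mult_right)
  then show ?thesis by (simp add: divide_inverse)
qed

text \<open>The variable y enters the Fourier integrals only through a cosine of modulus at most 1.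
  Hence the difference of the densities is at most twice the integral of |F_N -
  \<open>phi_lim\<close>|, a bound free of y, and that integral tends to 0 by dominated convergence.
  The same majorant bounds g.\<close>

lemma smoothed_density_uniform_limit:
  fixes C2 :: real
  assumes C2: "0 < C2" "C2 < 1 / ln 4"
  defines "\<delta> \<equiv> \<lambda>N. exp (- C2 * (ln (real N))\<^sup>2)"
  shows "uniform_limit UNIV (\<lambda>N. smoothed_density N (\<delta> N)) g sequentially"
    and "\<exists>G. \<forall>y. \<bar>g y\<bar> \<le> G"
proof -
  obtain C' where C': "C2 < C'" "C' < 1 / ln 4" using C2 dense by blast
  define F where "F N u = phi N u * exp (- 2 * pi\<^sup>2 * (\<delta> N)\<^sup>2 * u\<^sup>2)" for N u
  obtain A where A: "A \<ge> 1" and "\<forall>\<^sub>F N in sequentially. \<forall>u\<ge>0. \<bar>F N u\<bar> \<le> A / (1 + u\<^sup>2)"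
    unfolding F_def \<delta>_def using smoothed_phi_decay[OF C2(1) C'] by blast
  then obtain N0 where N0: "\<And>N u. N \<ge> N0 \<Longrightarrow> u \<ge> 0 \<Longrightarrow> \<bar>F N u\<bar> \<le> A / (1 + u\<^sup>2)"
    by (auto simp: eventually_at_top_linorder)
  have "\<delta> \<longlonglongrightarrow> 0" unfolding \<delta>_def using C2 by real_asymp
  then have lim: "(\<lambda>N. F N u) \<longlonglongrightarrow> phi_lim u" for u
    unfolding F_def by (auto intro!: tendsto_eq_intros phi_tendsto_phi_lim)
  have lim_le: "\<bar>phi_lim u\<bar> \<le> A / (1 + u\<^sup>2)" if "u \<ge> 0" for u
    using tendsto_rabs[OF lim[of u]]
    by (rule LIMSEQ_le_const2) (use N0 that in blast)
  have meas [measurable]: "F N \<in> borel_measurable borel" for N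
    unfolding F_def[abs_def] by measurable
  note dom = set_integrable_inverse_one_plus_square[unfolded set_integrable_def]
  have bound: "set_integrable lborel {0..} f"
    if [measurable]: "f \<in> borel_measurable borel" and "\<And>u. u \<ge> 0 \<Longrightarrow> \<bar>f u\<bar> \<le> B / (1 + u\<^sup>2)" for f :: "real \<Rightarrow> real" and B
    unfolding set_integrable_def
    by (rule Bochner_Integration.integrable_bound[OF dom[of B]])
       (use that(2) in \<open>auto simp: indicator_def intro!: AE_I2 order_trans[OF that(2)] divide_right_mono\<close>)
  have cos_le: "\<bar>cos x * z\<bar> \<le> \<bar>z\<bar>" for x z :: real
    using mult_right_mono[OF abs_cos_le_one[of x] abs_ge_zero[of z]] by (simp add: abs_mult)
  have int_F: "set_integrable lborel {0..} (\<lambda>u. cos (2 * pi * u * y) * F N u)" if "N \<ge> N0" for N y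
    by (rule bound[of _ A]) (use N0[OF that] in \<open>auto intro: order_trans[OF cos_le]\<close>)
  have int_phi: "set_integrable lborel {0..} (\<lambda>u. cos (2 * pi * u * y) * phi_lim u)" for y
    by (rule bound[of _ A]) (use lim_le in \<open>auto intro: order_trans[OF cos_le]\<close>)
  have diff_le: "\<bar>F N u - phi_lim u\<bar> \<le> (2 * A) / (1 + u\<^sup>2)" if "N \<ge> N0" "u \<ge> 0" for N u
  proof -
    have "(2 * A) / (1 + u\<^sup>2) = A / (1 + u\<^sup>2) + A / (1 + u\<^sup>2)" by simp
    then show ?thesis using N0[OF that] lim_le[OF that(2)] by linarith
  qed
  have int_diff: "set_integrable lborel {0..} (\<lambda>u. \<bar>F N u - phi_lim u\<bar>)" if "N \<ge> N0" for N
    by (rule bound[of _ "2 * A"]) (use diff_le[OF that] in auto)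
  have g_eq: "g y = 2 * (LBINT u:{0..}. cos (2 * pi * u * y) * phi_lim u)" for y
    by (simp add: g_def phi_lim_def)
  \<comment> \<open>The index is shifted by N0 because the majorant is available only from N0
    on.\<close>
  have conv: "(\<lambda>N. LBINT u:{0..}. \<bar>F (N + N0) u - phi_lim u\<bar>) \<longlonglongrightarrow> (\<integral>u. 0 \<partial>(lborel :: real measure))"
    unfolding set_lebesgue_integral_def
  proof (rule integral_dominated_convergence[where w = "\<lambda>u. indicator {0..} u *\<^sub>R ((2 * A) / (1 + u\<^sup>2))"])
    show "integrable lborel (\<lambda>u::real. indicator {0..} u *\<^sub>R ((2 * A) / (1 + u\<^sup>2)))" by (rule dom)
    show "AE u in lborel. (\<lambda>N. indicator {0..} u *\<^sub>R \<bar>F (N + N0) u - phi_lim u\<bar>) \<longlonglongrightarrow> 0"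
    proof (rule AE_I2)
      fix u
      have "(\<lambda>N. \<bar>F (N + N0) u - phi_lim u\<bar>) \<longlonglongrightarrow> \<bar>phi_lim u - phi_lim u\<bar>"
        by (intro tendsto_rabs tendsto_diff tendsto_const LIMSEQ_ignore_initial_segment[OF lim])
      then show "(\<lambda>N. indicator {0..} u *\<^sub>R \<bar>F (N + N0) u - phi_lim u\<bar>) \<longlonglongrightarrow> 0"
        using tendsto_scaleR[OF tendsto_const[of "indicator {0..} u :: real"]] by fastforce
    qed
    show "AE u in lborel. norm (indicator {0..} u *\<^sub>R \<bar>F (N + N0) u - phi_lim u\<bar>) \<le> indicator {0..} u *\<^sub>R ((2 * A) / (1 + u\<^sup>2))" for N
      using diff_le[of "N + N0"] by (auto simp: indicator_def)
  qed (auto intro: borel_measurable_scaleR)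
  then have conv0: "(\<lambda>N. LBINT u:{0..}. \<bar>F N u - phi_lim u\<bar>) \<longlonglongrightarrow> 0"
    using LIMSEQ_offset[where k = N0 and f = "\<lambda>N. LBINT u:{0..}. \<bar>F N u - phi_lim u\<bar>"] by simp
  have diff: "\<bar>smoothed_density N (\<delta> N) y - g y\<bar> \<le> 2 * (LBINT u:{0..}. \<bar>F N u - phi_lim u\<bar>)" if "N \<ge> N0" for N y
  proof -
    have "smoothed_density N (\<delta> N) y - g y =
        2 * (LBINT u:{0..}. cos (2 * pi * u * y) * F N u - cos (2 * pi * u * y) * phi_lim u)"
      unfolding g_eq F_def using int_F[OF that, of y] int_phi[of y]
      by (subst smoothed_density_fourier) (auto simp: \<delta>_def F_def set_integral_diff)
    moreover have "\<bar>LBINT u:{0..}. cos (2 * pi * u * y) * F N u - cos (2 * pi * u * y) * phi_lim u\<bar>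
        \<le> (LBINT u:{0..}. \<bar>cos (2 * pi * u * y) * F N u - cos (2 * pi * u * y) * phi_lim u\<bar>)"
      using set_integral_norm_bound[OF set_integral_diff(1)[OF int_F[OF that, of y] int_phi[of y]]] by simp
    moreover have "\<dots> \<le> (LBINT u:{0..}. \<bar>F N u - phi_lim u\<bar>)"
    proof (rule set_integral_mono)
      show "set_integrable lborel {0..} (\<lambda>u. \<bar>cos (2 * pi * u * y) * F N u - cos (2 * pi * u * y) * phi_lim u\<bar>)"
        by (intro set_integrable_abs set_integral_diff(1) int_F[OF that] int_phi)
    qed (use int_diff[OF that] cos_le in \<open>auto simp: right_diff_distrib[symmetric]\<close>)
    ultimately show ?thesis by (simp add: abs_mult)
  qed
  show "uniform_limit UNIV (\<lambda>N. smoothed_density N (\<delta> N)) g sequentially"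
  proof (rule uniform_limitI)
    fix e :: real assume e: "e > 0"
    have "\<forall>\<^sub>F N in sequentially. (LBINT u:{0..}. \<bar>F N u - phi_lim u\<bar>) < e / 2"
      using order_tendstoD(2)[OF conv0, of "e / 2"] e by simp
    then show "\<forall>\<^sub>F N in sequentially. \<forall>y\<in>UNIV. dist (smoothed_density N (\<delta> N) y) (g y) < e"
      using eventually_ge_at_top[of N0]
    proof eventually_elim
      case (elim N)
      show ?case
      proof
        fix y
        show "dist (smoothed_density N (\<delta> N) y) (g y) < e"
          using diff[OF elim(2), of y] elim(1) by (simp add: dist_real_def)
      qed
    qed
  qed
  show "\<exists>G. \<forall>y. \<bar>g y\<bar> \<le> G"
  proof (intro exI allI)
    fix y
    have "\<bar>LBINT u:{0..}. cos (2 * pi * u * y) * phi_lim u\<bar> \<le> (LBINT u:{0..}. \<bar>cos (2 * pi * u * y) * phi_lim u\<bar>)"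
      using set_integral_norm_bound[OF int_phi[of y]] by simp
    also have "\<dots> \<le> (LBINT u:{0..}. A / (1 + u\<^sup>2))"
      by (rule set_integral_mono)
         (use lim_le int_phi in \<open>auto intro: set_integrable_abs set_integrable_inverse_one_plus_square order_trans[OF cos_le]\<close>)
    finally show "\<bar>g y\<bar> \<le> 2 * (LBINT u:{0..}. A / (1 + u\<^sup>2))" by (simp add: g_eq abs_mult)
  qed
qed

section \<open>Comparison with the smoothed sum\<close>

text \<open>The exponential is split into two equal factors. One is at most exp(-R^2/4) on J; the
  other is, up to the factor sqrt 2 in the normalisation, a Gaussian density of standard deviation
  sqrt 2 \<delta>, of total mass 1.\<close>

lemma set_integral_normal_density_tail:
  assumes "\<delta> > 0" "R \<ge> 0" and J [measurable]: "J \<in> sets borel"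
    and far: "\<And>y. y \<in> J \<Longrightarrow> R * \<delta> \<le> \<bar>y - t\<bar>"
  shows "(LBINT y:J. normal_density t \<delta> y) \<le> sqrt 2 * exp (- R\<^sup>2 / 4)"
proof -
  have le: "indicator J y *\<^sub>R normal_density t \<delta> y \<le> sqrt 2 * exp (- R\<^sup>2 / 4) * normal_density t (sqrt 2 * \<delta>) y" for y
  proof (cases "y \<in> J")
    case True
    have "(R * \<delta>)\<^sup>2 \<le> \<bar>y - t\<bar>\<^sup>2"
      using far[OF True] assms by (intro power_mono) auto
    then have "R\<^sup>2 / 4 \<le> (y - t)\<^sup>2 / (4 * \<delta>\<^sup>2)" using assms by (simp add: field_simps)
    moreover have "(y - t)\<^sup>2 / (2 * \<delta>\<^sup>2) = (y - t)\<^sup>2 / (4 * \<delta>\<^sup>2) + (y - t)\<^sup>2 / (4 * \<delta>\<^sup>2)"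
      by simp
    ultimately have "- (y - t)\<^sup>2 / (2 * \<delta>\<^sup>2) \<le> - R\<^sup>2 / 4 + - (y - t)\<^sup>2 / (4 * \<delta>\<^sup>2)" by linarith
    then have "exp (- (y - t)\<^sup>2 / (2 * \<delta>\<^sup>2)) \<le> exp (- R\<^sup>2 / 4) * exp (- (y - t)\<^sup>2 / (4 * \<delta>\<^sup>2))"
      by (simp only: exp_le_cancel_iff flip: exp_add)
    then have "1 / sqrt (2 * pi * \<delta>\<^sup>2) * exp (- (y - t)\<^sup>2 / (2 * \<delta>\<^sup>2))
        \<le> 1 / sqrt (2 * pi * \<delta>\<^sup>2) * (exp (- R\<^sup>2 / 4) * exp (- (y - t)\<^sup>2 / (4 * \<delta>\<^sup>2)))"
      by (intro mult_left_mono) auto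
    also have "\<dots> = sqrt 2 * exp (- R\<^sup>2 / 4) * normal_density t (sqrt 2 * \<delta>) y"
    proof -
      have "sqrt (2 * pi * (sqrt 2 * \<delta>)\<^sup>2) = sqrt 2 * sqrt (2 * pi * \<delta>\<^sup>2)"
        by (simp add: power_mult_distrib flip: real_sqrt_mult)
      moreover have "2 * (sqrt 2 * \<delta>)\<^sup>2 = 4 * \<delta>\<^sup>2" by (simp add: power_mult_distrib)
      ultimately show ?thesis unfolding normal_density_def by simp
    qed
    finally show ?thesis using True by (simp add: normal_density_def)
  qed (auto simp: normal_density_nonneg)
  have "(LBINT y:J. normal_density t \<delta> y) \<le> (\<integral>y. sqrt 2 * exp (- R\<^sup>2 / 4) * normal_density t (sqrt 2 * \<delta>) y \<partial>lborel)"
    unfolding set_lebesgue_integral_def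
    by (intro integral_mono integrable_mult_indicator integrable_mult_right integrable_normal_density le)
       (use assms in auto)
  also have "\<dots> = sqrt 2 * exp (- R\<^sup>2 / 4)" using assms by simp
  finally show ?thesis .
qed

lemma set_integrable_normal_density:
  "\<delta> > 0 \<Longrightarrow> J \<in> sets borel \<Longrightarrow> set_integrable lborel J (normal_density t \<delta>)"
  unfolding set_integrable_def by (intro integrable_mult_indicator) auto

lemma probX_eq_sum: "probX N I = (\<Sum>s\<in>signs N. indicator I (XN N s)) / 2 ^ N"
proof -
  have "signs N \<noteq> {}" using card_signs[of N] by auto
  then have "probX N I = real (card (signs N \<inter> {s. XN N s \<in> I})) / 2 ^ N"
    by (simp add: probX_def measure_pmf_of_set finite_signs card_signs)
  also have "real (card (signs N \<inter> {s. XN N s \<in> I})) = (\<Sum>s\<in>signs N. indicator {s. XN N s \<in> I} s)"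
    by (simp add: indicator_def finite_signs)
  finally show ?thesis by (simp add: indicator_def)
qed

lemma set_integral_smoothed_density:
  assumes "\<delta> > 0" "J \<in> sets borel"
  shows "(LBINT y:J. smoothed_density N \<delta> y) = (\<Sum>s\<in>signs N. LBINT y:J. normal_density (XN N s) \<delta> y) / 2 ^ N"
proof -
  have "(LBINT y:J. smoothed_density N \<delta> y) = (LBINT y:J. \<Sum>s\<in>signs N. normal_density (XN N s) \<delta> y) / 2 ^ N"
    unfolding smoothed_density_def by simp
  also have "(LBINT y:J. \<Sum>s\<in>signs N. normal_density (XN N s) \<delta> y) = (\<Sum>s\<in>signs N. LBINT y:J. normal_density (XN N s) \<delta> y)"
    unfolding set_lebesgue_integral_def scaleR_sum_right
    using set_integrable_normal_density[OF assms]
    by (intro Bochner_Integration.integral_sum) (simp add: set_integrable_def)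
  finally show ?thesis .
qed

lemma average_signs_mono:
  assumes "\<And>s. s \<in> signs N \<Longrightarrow> f s \<le> h s + c"
  shows "(\<Sum>s\<in>signs N. f s) / 2 ^ N \<le> (\<Sum>s\<in>signs N. h s) / 2 ^ N + (c::real)"
proof -
  have "(\<Sum>s\<in>signs N. f s) \<le> (\<Sum>s\<in>signs N. h s) + 2 ^ N * c"
    using sum_mono[of "signs N" f "\<lambda>s. h s + c"] assms by (simp add: sum.distrib card_signs)
  then show ?thesis by (simp add: field_simps)
qed

text \<open>The inequality is proved for each fixed value t of X_N and then averaged. If t lies in
  I, a Gaussian centred at t leaves the widened interval only by deviating at least R
  \<delta>.\<close>

lemma probX_le_smoothed:
  assumes "\<delta> > 0" "R \<ge> 0" "I \<subseteq> {a..b}"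
  shows "probX N I \<le> (LBINT y:{a - R * \<delta>..b + R * \<delta>}. smoothed_density N \<delta> y) + sqrt 2 * exp (- R\<^sup>2 / 4)"
proof -
  define J where "J = {a - R * \<delta>..b + R * \<delta>}"
  have J: "J \<in> sets borel" by (simp add: J_def)
  have "indicator I t \<le> (LBINT y:J. normal_density t \<delta> y) + sqrt 2 * exp (- R\<^sup>2 / 4)" for t
  proof (cases "t \<in> I")
    case True
    have "(LBINT y:J. normal_density t \<delta> y) + (LBINT y:-J. normal_density t \<delta> y)
        = (LBINT y:J \<union> -J. normal_density t \<delta> y)"
      using J assms by (intro set_integral_Un[symmetric] set_integrable_normal_density) auto
    also have "\<dots> = 1" using assms by (simp add: set_lebesgue_integral_def)
    finally have "(LBINT y:J. normal_density t \<delta> y) + (LBINT y:-J. normal_density t \<delta> y) = 1" .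
    moreover have "(LBINT y:-J. normal_density t \<delta> y) \<le> sqrt 2 * exp (- R\<^sup>2 / 4)"
    proof (rule set_integral_normal_density_tail)
      fix y assume "y \<in> - J"
      then have "y < a - R * \<delta> \<or> b + R * \<delta> < y" by (auto simp: J_def)
      moreover have "a \<le> t" "t \<le> b" using True assms(3) by auto
      ultimately show "R * \<delta> \<le> \<bar>y - t\<bar>" by linarith
    qed (use assms J in auto)
    ultimately show ?thesis using True by simp
  next
    case False
    have "0 \<le> (LBINT y:J. normal_density t \<delta> y)"
      unfolding set_lebesgue_integral_def by (intro Bochner_Integration.integral_nonneg) auto
    then show ?thesis using False by simp
  qed
  then show ?thesis
    unfolding probX_eq_sum J_def[symmetric] set_integral_smoothed_density[OF assms(1) J]
    by (intro average_signs_mono)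
qed

text \<open>Dual to \<open>probX_le_smoothed\<close>: a point t outside I is at distance at least R
  \<delta> from every point of the shrunken interval. The open interval in the hypothesis allows I
  to omit its endpoints.\<close>

lemma smoothed_le_probX:
  assumes "\<delta> > 0" "R \<ge> 0" "{a<..<b} \<subseteq> I"
  shows "(LBINT y:{a + R * \<delta>..b - R * \<delta>}. smoothed_density N \<delta> y) \<le> probX N I + sqrt 2 * exp (- R\<^sup>2 / 4)"
proof -
  define J where "J = {a + R * \<delta>..b - R * \<delta>}"
  have J: "J \<in> sets borel" by (simp add: J_def)
  have "(LBINT y:J. normal_density t \<delta> y) \<le> indicator I t + sqrt 2 * exp (- R\<^sup>2 / 4)" for t
  proof (cases "t \<in> I")
    case True
    have "(LBINT y:J. normal_density t \<delta> y) \<le> (LBINT y:UNIV. normal_density t \<delta> y)"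
      unfolding set_lebesgue_integral_def
      by (intro integral_mono integrable_mult_indicator) (use J assms in \<open>auto simp: indicator_def\<close>)
    also have "\<dots> = 1" using assms by (simp add: set_lebesgue_integral_def)
    also have "1 \<le> 1 + sqrt 2 * exp (- R\<^sup>2 / 4)" by simp
    finally show ?thesis using True by simp
  next
    case False
    then have "t \<le> a \<or> b \<le> t" using assms(3) by force
    then have "(LBINT y:J. normal_density t \<delta> y) \<le> sqrt 2 * exp (- R\<^sup>2 / 4)"
      using assms J by (intro set_integral_normal_density_tail) (auto simp: J_def)
    then show ?thesis using False by simp
  qed
  then show ?thesis
    unfolding probX_eq_sum J_def[symmetric] set_integral_smoothed_density[OF assms(1) J]
    by (intro average_signs_mono)
qed

text \<open>On B - A the integrand is at most K. This pays for replacing I by the widened interval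
  in the upper estimate, and the shrunken interval by I in the lower one.\<close>

lemma set_integral_le_superset:
  fixes h :: "real \<Rightarrow> real"
  assumes "integrable lborel h" "\<And>y. h y \<le> K"
    and A: "A \<in> sets borel" and B: "B \<in> sets borel" "emeasure lborel B < \<infinity>" and "A \<subseteq> B"
  shows "(LBINT y:B. h y) \<le> (LBINT y:A. h y) + K * (measure lborel B - measure lborel A)"
proof -
  have fin: "emeasure lborel A < \<infinity>"
    using emeasure_mono[OF \<open>A \<subseteq> B\<close>, of lborel] B by (auto intro: le_less_trans)
  have int: "set_integrable lborel A h" "set_integrable lborel B h"
    unfolding set_integrable_def using assms by (auto simp del: real_scaleR_def intro!: integrable_mult_indicator)
  have "(LBINT y:B. h y) - (LBINT y:A. h y) = (\<integral>y. indicator B y * h y - indicator A y * h y \<partial>lborel)"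
    using int unfolding set_lebesgue_integral_def set_integrable_def by simp
  also have "\<dots> \<le> (\<integral>y. K * (indicator B y - indicator A y) \<partial>lborel)"
  proof (rule integral_mono)
    show "integrable lborel (\<lambda>y. K * (indicator B y - indicator A y))"
      using A B fin by (intro integrable_mult_right Bochner_Integration.integrable_diff integrable_real_indicator) auto
    show "integrable lborel (\<lambda>y. indicator B y * h y - indicator A y * h y)"
      using int unfolding set_integrable_def by simp
  qed (use assms(2) \<open>A \<subseteq> B\<close> in \<open>auto simp: indicator_def\<close>)
  also have "\<dots> = K * (measure lborel B - measure lborel A)"
    using A B fin by (simp add: integrable_real_indicator)
  finally show ?thesis by simp
qed

text \<open>The two inclusions cover open, closed and half-open bounded intervals with endpoints a
  and b at once. Uniformity lies in N0 being chosen before a, b and I.\<close>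

theorem theorem2p1:
  fixes C :: real
  assumes "0 < C" and "C < 1 / ln 4"
  shows "\<forall>\<epsilon>>0. \<exists>N0::nat. \<forall>N\<ge>N0. \<forall>(a::real) (b::real) (I::real set).
           b - a > exp (- C * (ln (real N))^2) \<and> {a<..<b} \<subseteq> I \<and> I \<subseteq> {a..b} \<longrightarrow>
           \<bar>probX N I - (LBINT x:I. g x)\<bar> \<le> \<epsilon> * (b - a)"
proof (intro allI impI)
  fix \<epsilon> :: real assume "\<epsilon> > 0"
  \<comment> \<open>The smoothing scale exp(-C2 (log N)^2) must be negligible against the length of
    I, hence C2 > C, yet remain in the range where \<open>phi\<close> decays, hence C2 < 1/log
    4.\<close>
  obtain C2 where C2: "C < C2" "C2 < 1 / ln 4" using assms(2) dense by blast
  have C2_pos: "0 < C2" using assms C2 by simp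
  define \<delta> where "\<delta> N = exp (- C2 * (ln (real N))\<^sup>2)" for N
  \<comment> \<open>Any slowly growing R keeps R \<delta> negligible against exp(-C (log N)^2); the
    square of the logarithm makes the tail exp(-(log N)^4/4) negligible too.\<close>
  define R where "R N = (ln (real N))\<^sup>2" for N
  define h where "h N = smoothed_density N (\<delta> N)" for N
  have \<delta>: "\<delta> N > 0" for N by (simp add: \<delta>_def)
  have unif: "uniform_limit UNIV h g sequentially"
    unfolding h_def \<delta>_def using smoothed_density_uniform_limit(1)[OF C2_pos C2(2)] .
  obtain G0 where "\<And>y. \<bar>g y\<bar> \<le> G0"
    using smoothed_density_uniform_limit(2)[OF C2_pos C2(2)] by blast
  then obtain G where G: "G \<ge> 0" "\<And>y. \<bar>g y\<bar> \<le> G" using abs_ge_zero order_trans by metis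
  have h_meas [measurable]: "h N \<in> borel_measurable borel" for N by (simp add: h_def)
  have g_meas [measurable]: "g \<in> borel_measurable borel"
    using tendsto_uniform_limitI[OF unif] by (intro borel_measurable_LIMSEQ_real[of borel h g]) auto
  \<comment> \<open>The errors add up to (2 G + 3) \<eta> l for an interval of length l. The cap 1/2
    gives 2 \<eta> <= 1 in \<open>wG\<close> and 2 w <= l in \<open>w2\<close>.\<close>
  define \<eta> where "\<eta> = min (1 / 2) (\<epsilon> / (2 * G + 4))"
  have "0 < \<eta>" using \<open>\<epsilon> > 0\<close> G(1) by (simp add: \<eta>_def)
  moreover have "\<eta> \<le> 1 / 2" "\<eta> \<le> \<epsilon> / (2 * G + 4)"
    unfolding \<eta>_def by (rule min.cobounded1, rule min.cobounded2)
  ultimately have \<eta>: "0 < \<eta>" "\<eta> \<le> 1 / 2" "\<eta> \<le> \<epsilon> / (2 * G + 4)" by blast+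
  have \<eta>_le: "\<eta> * (2 * G + 4) \<le> \<epsilon>" using \<eta>(3) G(1) by (simp add: field_simps)
  have "\<forall>\<^sub>F N in sequentially. R N * \<delta> N \<le> \<eta> * exp (- C * (ln (real N))\<^sup>2)"
    unfolding R_def \<delta>_def using C2 C2_pos assms(1) \<eta>(1) by real_asymp
  moreover have "\<forall>\<^sub>F N in sequentially. sqrt 2 * exp (- (R N)\<^sup>2 / 4) \<le> \<eta> * exp (- C * (ln (real N))\<^sup>2)"
    unfolding R_def using assms(1) \<eta>(1) by real_asymp
  moreover have "\<forall>\<^sub>F N in sequentially. \<forall>y\<in>UNIV. dist (h N y) (g y) < \<eta>"
    using uniform_limitD[OF unif \<eta>(1)] .
  ultimately have "\<forall>\<^sub>F N in sequentially. \<forall>(a::real) (b::real) (I::real set).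
           b - a > exp (- C * (ln (real N))^2) \<and> {a<..<b} \<subseteq> I \<and> I \<subseteq> {a..b} \<longrightarrow>
           \<bar>probX N I - (LBINT x:I. g x)\<bar> \<le> \<epsilon> * (b - a)"
    using eventually_ge_at_top[of 2]
  proof eventually_elim
    case (elim N)
    define w where "w = R N * \<delta> N"
    define \<tau> where "\<tau> = sqrt 2 * exp (- (R N)\<^sup>2 / 4)"
    have R: "R N > 0" using elim(4) by (simp add: R_def)
    have w: "w > 0" using R \<delta> by (simp add: w_def)
    have hg: "\<bar>h N y - g y\<bar> \<le> \<eta>" for y using elim(3) by (auto simp: dist_real_def less_imp_le)
    have hG: "h N y \<le> G + \<eta>" for y using hg[of y] G(2)[of y] by linarith
    have h_int: "integrable lborel (h N)" unfolding h_def by (rule integrable_smoothed_density[OF \<delta>])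
    show ?case
    proof (intro allI impI)
      fix a b :: real and I :: "real set"
      assume *: "b - a > exp (- C * (ln (real N))^2) \<and> {a<..<b} \<subseteq> I \<and> I \<subseteq> {a..b}"
      define l where "l = b - a"
      have l0: "l > 0" using * unfolding l_def by (meson exp_gt_zero less_trans)
      have "\<eta> * exp (- C * (ln (real N))\<^sup>2) \<le> \<eta> * l"
        using * \<eta>(1) by (intro mult_left_mono) (auto simp: l_def)
      then have wl: "w \<le> \<eta> * l" and \<tau>l: "\<tau> \<le> \<eta> * l" using elim(1,2) by (auto simp: w_def \<tau>_def)
      have "\<eta> * l \<le> 1 / 2 * l" using \<eta> l0 by (intro mult_right_mono) auto
      then have w2: "2 * w \<le> l" using wl by simp
      \<comment> \<open>I differs from an open interval by at most two points, which makes it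
        Borel.\<close>
      have "I = {a<..<b} \<union> (I \<inter> {a, b})" using * by force
      moreover have "I \<inter> {a, b} \<in> sets borel" by (rule sets.countable) (auto intro: countable_finite)
      ultimately have I [measurable]: "I \<in> sets borel" by (metis borel_open open_greaterThanLessThan sets.Un)
      have eI: "emeasure lborel I = ennreal l"
      proof (rule antisym)
        show "emeasure lborel I \<le> ennreal l"
          using emeasure_mono[of I "{a..b}" lborel] * l0 by (simp add: l_def)
        show "ennreal l \<le> emeasure lborel I"
          using emeasure_mono[of "{a<..<b}" I lborel] * l0 by (simp add: l_def)
      qed
      then have mI: "measure lborel I = l" using l0 by (simp add: measure_def)
      have gI: "set_integrable lborel I g" and hI: "set_integrable lborel I (h N)"
        and cI: "set_integrable lborel I (\<lambda>_. \<eta>)"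
      proof -
        have cI: "set_integrable lborel I (\<lambda>_. c)" for c :: real
          unfolding set_integrable_def using eI by (simp add: integrable_real_indicator)
        then show "set_integrable lborel I (\<lambda>_. \<eta>)" .
        show "set_integrable lborel I (h N)"
          unfolding set_integrable_def using h_int by (intro integrable_mult_indicator) auto
        show "set_integrable lborel I g"
          using G(2) by (intro set_integrable_bound[OF cI[of G]]) (auto simp: set_borel_measurable_def G(1))
      qed
      have diff: "\<bar>(LBINT x:I. h N x) - (LBINT x:I. g x)\<bar> \<le> \<eta> * l"
      proof -
        have "\<bar>(LBINT x:I. h N x) - (LBINT x:I. g x)\<bar> = norm (LBINT x:I. h N x - g x)"
          using gI hI by (simp add: set_integral_diff)
        also have "\<dots> \<le> (LBINT x:I. norm (h N x - g x))"
          using gI hI by (intro set_integral_norm_bound set_integral_diff)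
        also have "\<dots> \<le> (LBINT x:I. \<eta>)"
          using gI hI cI hg by (intro set_integral_mono set_integrable_norm set_integral_diff) auto
        also have "\<dots> = \<eta> * l" using mI by (simp add: set_lebesgue_integral_def)
        finally show ?thesis .
      qed
      have wG: "(G + \<eta>) * (2 * w) \<le> (2 * G + 1) * (\<eta> * l)"
      proof -
        have "(G + \<eta>) * (2 * w) = (2 * G + 2 * \<eta>) * w" by (simp add: algebra_simps)
        also have "\<dots> \<le> (2 * G + 1) * (\<eta> * l)" using wl w \<eta> G(1) by (intro mult_mono) auto
        finally show ?thesis .
      qed
      \<comment> \<open>Three errors: \<eta> l from replacing h by g, (G + \<eta>) 2 w from the two
        added margins of width w, and the Gaussian tail \<tau>.\<close>
      have up: "probX N I - (LBINT x:I. g x) \<le> \<eta> * l + (2 * G + 1) * (\<eta> * l) + \<eta> * l"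
      proof -
        have "probX N I \<le> (LBINT y:{a - w..b + w}. h N y) + \<tau>"
          unfolding w_def \<tau>_def h_def using \<delta> R * by (intro probX_le_smoothed) auto
        moreover have "(LBINT y:{a - w..b + w}. h N y) \<le> (LBINT y:I. h N y) + (G + \<eta>) * (measure lborel {a - w..b + w} - measure lborel I)"
          using * w by (intro set_integral_le_superset h_int hG I) (auto simp: emeasure_lborel_Icc_eq)
        moreover have "measure lborel {a - w..b + w} - measure lborel I = 2 * w"
          using w l0 by (simp add: mI l_def)
        ultimately show ?thesis using diff wG \<tau>l by (simp add: abs_le_iff)
      qed
      have low: "(LBINT x:I. g x) - probX N I \<le> \<eta> * l + (2 * G + 1) * (\<eta> * l) + \<eta> * l"
      proof -
        have "(LBINT y:{a + w..b - w}. h N y) \<le> probX N I + \<tau>"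
          unfolding w_def \<tau>_def h_def using \<delta> R * by (intro smoothed_le_probX) auto
        moreover have "{a + w..b - w} \<subseteq> I" using * w by force
        then have "(LBINT y:I. h N y) \<le> (LBINT y:{a + w..b - w}. h N y) + (G + \<eta>) * (measure lborel I - measure lborel {a + w..b - w})"
          using eI by (intro set_integral_le_superset h_int hG I) auto
        \<comment> \<open>By \<open>w2\<close> the shrunken interval has length exactly l - 2 w,
          without truncation at 0.\<close>
        moreover have "measure lborel I - measure lborel {a + w..b - w} = 2 * w"
          using w2 by (simp add: mI l_def)
        ultimately show ?thesis using diff wG \<tau>l by (simp add: abs_le_iff)
      qed
      have "\<eta> * l + (2 * G + 1) * (\<eta> * l) + \<eta> * l \<le> \<eta> * (2 * G + 4) * l"
        using \<eta>(1) l0 by (simp add: algebra_simps)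
      also have "\<dots> \<le> \<epsilon> * l" using \<eta>_le l0 by (intro mult_right_mono) auto
      finally show "\<bar>probX N I - (LBINT x:I. g x)\<bar> \<le> \<epsilon> * (b - a)"
        using up low unfolding l_def by linarith
    qed
  qed
  then show "\<exists>N0::nat. \<forall>N\<ge>N0. \<forall>(a::real) (b::real) (I::real set).
           b - a > exp (- C * (ln (real N))^2) \<and> {a<..<b} \<subseteq> I \<and> I \<subseteq> {a..b} \<longrightarrow>
           \<bar>probX N I - (LBINT x:I. g x)\<bar> \<le> \<epsilon> * (b - a)"
    by (simp only: eventually_at_top_linorder)
qed

end
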